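(* Let $r\ge 2$, let $e=r+2$ (so $e\ge 4$), and let $k,l\in\{0,1\}$. There is an isomorphism from $G(k,l)$ to $G_2(e;k,l)$ sending the generators $a$ and $x$ of $G(k,l)$ to $a_1$ and $a_1^{-1}b_1$ respectively.
   Context: Conventions: $x^y=y^{-1}xy$ and $[x,y]=x^{-1}y^{-1}xy$. For $r\ge 2$ and $k,l\in\{0,1\}$, $G(k,l)$ denotes the group with presentation $$\begin{aligned}G(k,l)=\langle a,x\mid\ & a^{2^{r+2}}=1,\ [a,x]=v,\ [v,a]=b,\ v^{2^{r+1}}=b^{2^r}=[v,b]=1,\\ & v^{2^r}=z,\ b^{2^{r-1}}=u,\ x^2=z^k,\ b^x=b^{-1},\ v^x=v^{-1},\ b^a=b^{-1},\\ & a^4=v^{-2}b^{-1}w,\ w=z^l\rangle,\end{aligned}$$ where $v,b,z,u,w$ are abbreviations for the elements defined by the relations $v=[a,x]$, $b=[v,a]$, $z=v^{2^r}$, $u=b^{2^{r-1}}$, $w=z^l$. For $e\ge 3$ and $k,l\in\{0,1\}$, $G_2(e;k,l)$ denotes the group with presentation $$\begin{aligned}G_2(e;k,l)=\langle a_1,b_1\mid\ & a_1^{2^e}=b_1^{2^e}=[b_1^2,a_1^2]=1,\ [b_1,a_1]=a_1^2b_1^{-2}(a_1^{2^{e-1}}b_1^{2^{e-1}})^k,\\ & (b_1^2)^{a_1}=b_1^{-2}(a_1^{2^{e-1}}b_1^{2^{e-1}})^l,\ (a_1^2)^{b_1}=a_1^{-2}(a_1^{2^{e-1}}b_1^{2^{e-1}})^l\rangle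 .\end{aligned}$$ *)

theory Defs
  imports "HOL-Algebra.Group"
begin

section \<open>Groups given by generators and relations\<close>

text \<open>A letter \<open>Pos g\<close> stands for the generator \<open>g\<close> and \<open>Neg g\<close> for its formal inverse.\<close>

datatype 'g letter = Pos 'g | Neg 'g

type_synonym 'g word = "'g letter list"

fun flip_letter :: "'g letter \<Rightarrow> 'g letter" where
  "flip_letter (Pos g) = Neg g"
| "flip_letter (Neg g) = Pos g"

definition winv :: "'g word \<Rightarrow> 'g word" where
  "winv w = rev (map flip_letter w)"

fun wpow :: "'g word \<Rightarrow> nat \<Rightarrow> 'g word" where
  "wpow w 0 = []"
| "wpow w (Suc n) = w @ wpow w n"

text \<open>The conventions are \<open>x\<^sup>y = y\<^sup>-\<^sup>1 x y\<close> and \<open>[x, y] = x\<^sup>-\<^sup>1 y\<^sup>-\<^sup>1 x y\<close>.\<close>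

definition wconj :: "'g word \<Rightarrow> 'g word \<Rightarrow> 'g word" where
  "wconj x y = winv y @ x @ y"

definition wcomm :: "'g word \<Rightarrow> 'g word \<Rightarrow> 'g word" where
  "wcomm x y = winv x @ winv y @ x @ y"

text \<open>A set \<open>R\<close> of pairs of words is read as the set of relations \<open>u = v\<close> for \<open>(u, v) \<in> R\<close>.
  Two words are equal in the group presented by \<open>R\<close> iff they are related by the least congruence
  on the monoid of words that cancels inverse letters and contains \<open>R\<close>.\<close>

inductive pres_eq :: "('g word \<times> 'g word) set \<Rightarrow> 'g word \<Rightarrow> 'g word \<Rightarrow> bool"
  for R :: "('g word \<times> 'g word) set" where
  pres_refl: "pres_eq R u u"
| pres_sym: "pres_eq R u v \<Longrightarrow> pres_eq R v u"
| pres_trans: "pres_eq R u v \<Longrightarrow> pres_eq R v w \<Longrightarrow> pres_eq R u w"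
| pres_append: "pres_eq R u u' \<Longrightarrow> pres_eq R v v' \<Longrightarrow> pres_eq R (u @ v) (u' @ v')"
| pres_cancel: "pres_eq R [c, flip_letter c] []"
| pres_rel: "(u, v) \<in> R \<Longrightarrow> pres_eq R u v"

definition pres_class :: "('g word \<times> 'g word) set \<Rightarrow> 'g word \<Rightarrow> 'g word set" where
  "pres_class R w = {w'. pres_eq R w w'}"

definition pres_group :: "('g word \<times> 'g word) set \<Rightarrow> 'g word set monoid" where
  "pres_group R =
     \<lparr>carrier = range (pres_class R),
      monoid.mult = (\<lambda>A B. \<Union>u\<in>A. \<Union>v\<in>B. pres_class R (u @ v)),
      one = pres_class R []\<rparr>"

definition pres_gen :: "('g word \<times> 'g word) set \<Rightarrow> 'g \<Rightarrow> 'g word set" where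
  "pres_gen R g = pres_class R [Pos g]"

lemma pres_class_eq_iff: "pres_class R u = pres_class R v \<longleftrightarrow> pres_eq R u v"
proof
  assume "pres_class R u = pres_class R v"
  moreover have "v \<in> pres_class R v" by (simp add: pres_class_def pres_refl)
  ultimately have "v \<in> pres_class R u" by simp
  then show "pres_eq R u v" by (simp add: pres_class_def)
next
  assume uv: "pres_eq R u v"
  have "pres_eq R u w \<longleftrightarrow> pres_eq R v w" for w
    using pres_trans[OF uv] pres_trans[OF pres_sym[OF uv]] by metis
  then show "pres_class R u = pres_class R v" by (simp add: pres_class_def)
qed

lemma pres_group_mult:
  "pres_class R u \<otimes>\<^bsub>pres_group R\<^esub> pres_class R v = pres_class R (u @ v)"
proof -
  have "pres_class R (u' @ v') = pres_class R (u @ v)"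
    if "u' \<in> pres_class R u" "v' \<in> pres_class R v" for u' v'
  proof -
    have "pres_eq R u u'" "pres_eq R v v'" using that by (simp_all add: pres_class_def)
    then have "pres_eq R (u @ v) (u' @ v')" by (rule pres_append)
    then show ?thesis by (simp add: pres_class_eq_iff pres_sym)
  qed
  moreover have "u \<in> pres_class R u" "v \<in> pres_class R v"
    by (simp_all add: pres_class_def pres_refl)
  ultimately have "(\<Union>u'\<in>pres_class R u. \<Union>v'\<in>pres_class R v. pres_class R (u' @ v'))
      = pres_class R (u @ v)"
    by blast
  then show ?thesis by (simp add: pres_group_def)
qed

lemma pres_eq_winv_left: "pres_eq R (winv w @ w) []"
proof (induction w)
  case Nil
  show ?case by (simp add: winv_def pres_refl)
next
  case (Cons c w)
  have "flip_letter (flip_letter c) = c" by (cases c) auto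
  then have "pres_eq R [flip_letter c, c] []"
    using pres_cancel[of R "flip_letter c"] by simp
  then have "pres_eq R (winv w @ [flip_letter c, c] @ w) (winv w @ [] @ w)"
    by (intro pres_append pres_refl)
  then have "pres_eq R (winv (c # w) @ c # w) (winv w @ w)"
    by (simp add: winv_def)
  then show ?case using Cons.IH by (rule pres_trans)
qed

lemma group_pres_group: "group (pres_group R)"
proof (rule groupI)
  fix A assume "A \<in> carrier (pres_group R)"
  then obtain w where w: "A = pres_class R w" by (auto simp: pres_group_def)
  have "pres_class R (winv w) \<otimes>\<^bsub>pres_group R\<^esub> A = \<one>\<^bsub>pres_group R\<^esub>"
  proof -
    have "pres_class R (winv w @ w) = pres_class R []"
      using pres_eq_winv_left by (simp only: pres_class_eq_iff)
    then show ?thesis unfolding w pres_group_mult by (simp add: pres_group_def)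
  qed
  then show "\<exists>B\<in>carrier (pres_group R). B \<otimes>\<^bsub>pres_group R\<^esub> A = \<one>\<^bsub>pres_group R\<^esub>"
    by (auto simp: pres_group_def)
next
  fix A assume "A \<in> carrier (pres_group R)"
  then obtain w where w: "A = pres_class R w" by (auto simp: pres_group_def)
  have "\<one>\<^bsub>pres_group R\<^esub> = pres_class R []" by (simp add: pres_group_def)
  then show "\<one>\<^bsub>pres_group R\<^esub> \<otimes>\<^bsub>pres_group R\<^esub> A = A" by (simp add: w pres_group_mult)
next
  fix A B assume "A \<in> carrier (pres_group R)" "B \<in> carrier (pres_group R)"
  then obtain u v where "A = pres_class R u" "B = pres_class R v"
    by (auto simp: pres_group_def)
  then have "A \<otimes>\<^bsub>pres_group R\<^esub> B = pres_class R (u @ v)" by (simp add: pres_group_mult)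
  then show "A \<otimes>\<^bsub>pres_group R\<^esub> B \<in> carrier (pres_group R)" by (simp add: pres_group_def)
next
  fix A B C
  assume "A \<in> carrier (pres_group R)" "B \<in> carrier (pres_group R)" "C \<in> carrier (pres_group R)"
  then obtain u v w where "A = pres_class R u" "B = pres_class R v" "C = pres_class R w"
    by (auto simp: pres_group_def)
  then show "A \<otimes>\<^bsub>pres_group R\<^esub> B \<otimes>\<^bsub>pres_group R\<^esub> C
      = A \<otimes>\<^bsub>pres_group R\<^esub> (B \<otimes>\<^bsub>pres_group R\<^esub> C)"
    by (simp add: pres_group_mult)
qed (simp add: pres_group_def)

text \<open>Von Dyck's theorem: \<open>pres_group R\<close> has the universal property of the presentation.\<close>

fun weval :: "('a, 'b) monoid_scheme \<Rightarrow> ('g \<Rightarrow> 'a) \<Rightarrow> 'g word \<Rightarrow> 'a" where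
  "weval H f [] = \<one>\<^bsub>H\<^esub>"
| "weval H f (Pos g # w) = f g \<otimes>\<^bsub>H\<^esub> weval H f w"
| "weval H f (Neg g # w) = inv\<^bsub>H\<^esub> (f g) \<otimes>\<^bsub>H\<^esub> weval H f w"

context group
begin

lemma weval_closed:
  assumes "range f \<subseteq> carrier G"
  shows "weval G f w \<in> carrier G"
proof (induction w)
  case (Cons c w)
  moreover have "f g \<in> carrier G" for g using assms by auto
  ultimately show ?case by (cases c) simp_all
qed simp

lemma weval_append:
  assumes "range f \<subseteq> carrier G"
  shows "weval G f (u @ v) = weval G f u \<otimes> weval G f v"
  using assms
proof (induction u)
  case (Cons c u)
  moreover have "f g \<in> carrier G" for g using assms by auto
  ultimately show ?case
    by (cases c) (simp_all add: weval_closed m_assoc)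
qed (simp add: weval_closed)

lemma weval_pres_eq:
  assumes f: "range f \<subseteq> carrier G"
    and R: "\<And>u v. (u, v) \<in> R \<Longrightarrow> weval G f u = weval G f v"
    and "pres_eq R u v"
  shows "weval G f u = weval G f v"
  using assms(3)
proof induction
  case (pres_cancel c)
  have "f g \<in> carrier G" for g using f by auto
  then show ?case by (cases c) simp_all
qed (simp_all add: weval_append[OF f] R)

lemma pres_group_universal:
  assumes f: "range f \<subseteq> carrier G"
    and R: "\<And>u v. (u, v) \<in> R \<Longrightarrow> weval G f u = weval G f v"
  shows "\<exists>\<phi>\<in>hom (pres_group R) G. \<forall>w. \<phi> (pres_class R w) = weval G f w"
proof -
  define \<phi> where "\<phi> A = weval G f (SOME w. w \<in> A)" for A
  have \<phi>: "\<phi> (pres_class R w) = weval G f w" for w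
  proof -
    have "w \<in> pres_class R w" by (simp add: pres_class_def pres_refl)
    then have "(SOME w'. w' \<in> pres_class R w) \<in> pres_class R w" by (rule someI)
    then show ?thesis
      unfolding \<phi>_def using weval_pres_eq[OF f R] by (simp add: pres_class_def)
  qed
  have "\<phi> \<in> hom (pres_group R) G"
  proof (rule homI)
    fix A assume "A \<in> carrier (pres_group R)"
    then show "\<phi> A \<in> carrier G" by (auto simp: pres_group_def \<phi> weval_closed[OF f])
  next
    fix A B assume "A \<in> carrier (pres_group R)" "B \<in> carrier (pres_group R)"
    then obtain u v where "A = pres_class R u" "B = pres_class R v"
      by (auto simp: pres_group_def)
    then show "\<phi> (A \<otimes>\<^bsub>pres_group R\<^esub> B) = \<phi> A \<otimes> \<phi> B"
      by (simp add: pres_group_mult \<phi> weval_append[OF f])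
  qed
  with \<phi> show ?thesis by blast
qed

end

section \<open>The two families of groups\<close>

datatype gens_G = gen_a | gen_x

text \<open>Here \<open>v\<close>, \<open>b\<close>, \<open>z\<close> and \<open>w\<close> abbreviate words in the two generators \<open>a\<close>, \<open>x\<close>.
  The element \<open>u = b ^ (2 ^ (r - 1))\<close> occurs in no other relation and so is not introduced.\<close>

definition rels_G :: "nat \<Rightarrow> nat \<Rightarrow> nat \<Rightarrow> (gens_G word \<times> gens_G word) set" where
  "rels_G r k l =
    (let a = [Pos gen_a]; x = [Pos gen_x];
         v = wcomm a x; b = wcomm v a;
         z = wpow v (2 ^ r); w = wpow z l
     in {(wpow a (2 ^ (r + 2)), []),
         (wpow v (2 ^ (r + 1)), []),
         (wpow b (2 ^ r), []),
         (wcomm v b, []),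
         (wpow x 2, wpow z k),
         (wconj b x, winv b),
         (wconj v x, winv v),
         (wconj b a, winv b),
         (wpow a 4, wpow (winv v) 2 @ winv b @ w)})"

definition grp_G :: "nat \<Rightarrow> nat \<Rightarrow> nat \<Rightarrow> gens_G word set monoid" where
  "grp_G r k l = pres_group (rels_G r k l)"

datatype gens_G2 = gen_a1 | gen_b1

definition rels_G2 :: "nat \<Rightarrow> nat \<Rightarrow> nat \<Rightarrow> (gens_G2 word \<times> gens_G2 word) set" where
  "rels_G2 e k l =
    (let a = [Pos gen_a1]; b = [Pos gen_b1];
         c = wpow a (2 ^ (e - 1)) @ wpow b (2 ^ (e - 1))
     in {(wpow a (2 ^ e), []),
         (wpow b (2 ^ e), []),
         (wcomm (wpow b 2) (wpow a 2), []),
         (wcomm b a, wpow a 2 @ wpow (winv b) 2 @ wpow c k),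
         (wconj (wpow b 2) a, wpow (winv b) 2 @ wpow c l),
         (wconj (wpow a 2) b, wpow (winv a) 2 @ wpow c l)})"

definition grp_G2 :: "nat \<Rightarrow> nat \<Rightarrow> nat \<Rightarrow> gens_G2 word set monoid" where
  "grp_G2 e k l = pres_group (rels_G2 e k l)"

end

(* In G_2(e;k,l) put A = a_1^2, B = b_1^2 and c = A^(2^r) B^(2^r); then c is a central involution and
   A, B, c commute, so with x = a_1^-1 b_1 every abbreviation of G(k,l) becomes a monomial:
   v = A^-1 B c^k, b = B^-2 c^l and z = c. Conversely, in G(k,l) with y = a x, the element a^2
   centralises v and b, and y^2 = a^2 v z^k; so a^2, v, b, z commute and again all relations are
   monomial identities. The two resulting homomorphisms are mutually inverse on the generators. *)

theory Submission
  imports Defs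
begin

section \<open>Conjugates and commutators\<close>

context group
begin

definition conjug :: "'a \<Rightarrow> 'a \<Rightarrow> 'a" where
  "conjug x y = inv y \<otimes> (x \<otimes> y)"

definition commut :: "'a \<Rightarrow> 'a \<Rightarrow> 'a" where
  "commut x y = inv x \<otimes> (inv y \<otimes> (x \<otimes> y))"

lemma conjug_closed [simp]: "x \<in> carrier G \<Longrightarrow> y \<in> carrier G \<Longrightarrow> conjug x y \<in> carrier G"
  by (simp add: conjug_def)

lemma commut_closed [simp]: "x \<in> carrier G \<Longrightarrow> y \<in> carrier G \<Longrightarrow> commut x y \<in> carrier G"
  by (simp add: commut_def)

lemma inv_mult_cancel_left [simp]:
  "x \<in> carrier G \<Longrightarrow> y \<in> carrier G \<Longrightarrow> inv x \<otimes> (x \<otimes> y) = y"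
  "x \<in> carrier G \<Longrightarrow> y \<in> carrier G \<Longrightarrow> x \<otimes> (inv x \<otimes> y) = y"
  by (simp_all flip: m_assoc)

lemma conjug_mult:
  "x \<in> carrier G \<Longrightarrow> x' \<in> carrier G \<Longrightarrow> y \<in> carrier G \<Longrightarrow> conjug (x \<otimes> x') y = conjug x y \<otimes> conjug x' y"
  by (simp add: conjug_def m_assoc)

lemma conjug_inv: "x \<in> carrier G \<Longrightarrow> y \<in> carrier G \<Longrightarrow> conjug (inv x) y = inv (conjug x y)"
  by (simp add: conjug_def m_assoc inv_mult_group)

lemma conjug_pow:
  "x \<in> carrier G \<Longrightarrow> y \<in> carrier G \<Longrightarrow> conjug (x [^] (n::nat)) y = conjug x y [^] n"
proof (induction n)
  case (Suc n)
  then show ?case by (simp add: conjug_mult)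
qed (simp add: conjug_def)

lemma conjug_conjug:
  "x \<in> carrier G \<Longrightarrow> y \<in> carrier G \<Longrightarrow> y' \<in> carrier G \<Longrightarrow> conjug x (y \<otimes> y') = conjug (conjug x y) y'"
  by (simp add: conjug_def m_assoc inv_mult_group)

text \<open>Conjugation by \<open>inv y\<close> undoes conjugation by \<open>y\<close>. This yields
  the action of \<open>inv a\<close>, hence of \<open>inv a \<otimes> y\<close>, from relations that
  only give the action of \<open>a\<close> and \<open>y\<close>.\<close>

lemma conjug_invI:
  "x \<in> carrier G \<Longrightarrow> x' \<in> carrier G \<Longrightarrow> y \<in> carrier G \<Longrightarrow> conjug x y = x' \<Longrightarrow> conjug x' (inv y) = x"
  by (auto simp: conjug_def m_assoc)

lemma conjug_triv_iff:
  "x \<in> carrier G \<Longrightarrow> y \<in> carrier G \<Longrightarrow> conjug x y = x \<longleftrightarrow> x \<otimes> y = y \<otimes> x"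
  using inv_solve_left[of x y "x \<otimes> y"] by (auto simp: conjug_def)

lemma conjug_eq_mult_commut: "x \<in> carrier G \<Longrightarrow> y \<in> carrier G \<Longrightarrow> conjug x y = x \<otimes> commut x y"
  by (simp add: conjug_def commut_def)

lemma commut_eq_one_iff:
  "x \<in> carrier G \<Longrightarrow> y \<in> carrier G \<Longrightarrow> commut x y = \<one> \<longleftrightarrow> x \<otimes> y = y \<otimes> x"
  using conjug_eq_mult_commut[of x y] conjug_triv_iff[of x y] by (metis commut_closed l_cancel_one)

lemma inv_commut: "x \<in> carrier G \<Longrightarrow> y \<in> carrier G \<Longrightarrow> inv (commut x y) = commut y x"
  by (simp add: commut_def inv_mult_group m_assoc)

lemma pow_two: "x \<in> carrier G \<Longrightarrow> x [^] (2::nat) = x \<otimes> x"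
  by (simp add: numeral_2_eq_2)

lemma pow_two_pow_Suc: "x \<in> carrier G \<Longrightarrow> x [^] (2 ^ Suc n :: nat) = (x \<otimes> x) [^] (2 ^ n :: nat)"
  by (simp add: nat_pow_pow flip: pow_two)

lemma involution_pow_even:
  assumes "x \<in> carrier G" "x \<otimes> x = \<one>" "n \<ge> 1"
  shows "x [^] (2 ^ n :: nat) = \<one>"
  using assms by (cases n) (simp_all add: pow_two_pow_Suc del: power_Suc)

text \<open>Commuting with \<open>y\<close> means being fixed under conjugation by \<open>y\<close>,
  and conjugation respects powers.\<close>

lemma pow_commute:
  "x \<in> carrier G \<Longrightarrow> y \<in> carrier G \<Longrightarrow> x \<otimes> y = y \<otimes> x \<Longrightarrow> x [^] (n::nat) \<otimes> y = y \<otimes> x [^] n"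
  by (metis conjug_pow conjug_triv_iff nat_pow_closed)

lemma inv_commute:
  "x \<in> carrier G \<Longrightarrow> y \<in> carrier G \<Longrightarrow> x \<otimes> y = y \<otimes> x \<Longrightarrow> inv x \<otimes> y = y \<otimes> inv x"
  by (metis conjug_inv conjug_triv_iff inv_closed)

text \<open>Companion of a commutation rule inside right-bracketed products: together the two let
  the simplifier sort chosen commuting elements in a noncommutative group.\<close>

lemma commute_left:
  "x \<in> carrier G \<Longrightarrow> y \<in> carrier G \<Longrightarrow> w \<in> carrier G \<Longrightarrow> x \<otimes> y = y \<otimes> x \<Longrightarrow>
    x \<otimes> (y \<otimes> w) = y \<otimes> (x \<otimes> w)"
  by (metis m_assoc)

section \<open>Values of the word operations in a group\<close>

lemma weval_winv:
  assumes f: "range f \<subseteq> carrier G"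
  shows "weval G f (winv w) = inv (weval G f w)"
proof (induction w)
  case (Cons c w)
  have fg: "f g \<in> carrier G" for g using f by auto
  have "weval G f (winv (c # w)) = weval G f (winv w) \<otimes> weval G f [flip_letter c]"
    by (simp add: winv_def weval_append[OF f])
  then show ?case
    using Cons.IH by (cases c) (simp_all add: fg weval_closed[OF f] inv_mult_group)
qed (simp add: winv_def)

lemma weval_wpow:
  assumes f: "range f \<subseteq> carrier G"
  shows "weval G f (wpow w n) = weval G f w [^] n"
  by (induction n)
    (simp_all add: weval_append[OF f] weval_closed[OF f] pow_commute)

lemma weval_wconj:
  assumes f: "range f \<subseteq> carrier G"
  shows "weval G f (wconj u w) = conjug (weval G f u) (weval G f w)"
  by (simp add: wconj_def conjug_def weval_append[OF f] weval_winv[OF f])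

lemma weval_wcomm:
  assumes f: "range f \<subseteq> carrier G"
  shows "weval G f (wcomm u w) = commut (weval G f u) (weval G f w)"
  by (simp add: wcomm_def commut_def weval_append[OF f] weval_winv[OF f])

end

section \<open>Isomorphisms between presented groups\<close>

lemma weval_hom:
  assumes "group G" "group H" "\<phi> \<in> hom G H" "range f \<subseteq> carrier G"
  shows "\<phi> (weval G f w) = weval H (\<phi> \<circ> f) w"
proof -
  interpret group_hom G H \<phi> using assms by (simp add: group_hom_def group_hom_axioms_def)
  have fg: "f g \<in> carrier G" for g using assms by auto
  show ?thesis
  proof (induction w)
    case (Cons c w)
    then show ?case by (cases c) (simp_all add: fg G.weval_closed[OF assms(4)])
  qed simp
qed

lemma pres_gen_closed: "range (pres_gen R) \<subseteq> carrier (pres_group R)"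
  by (auto simp: pres_gen_def pres_group_def)

lemma inv_pres_gen: "inv\<^bsub>pres_group R\<^esub> pres_gen R g = pres_class R [Neg g]"
proof -
  have "pres_class R [Neg g] \<otimes>\<^bsub>pres_group R\<^esub> pres_gen R g = \<one>\<^bsub>pres_group R\<^esub>"
    using pres_cancel[of R "Neg g"]
    by (simp add: pres_gen_def pres_group_mult) (simp add: pres_group_def pres_class_eq_iff)
  moreover have "pres_class R [Neg g] \<in> carrier (pres_group R)" by (simp add: pres_group_def)
  ultimately show ?thesis
    using pres_gen_closed[of R] by (intro group.inv_equality[OF group_pres_group]) auto
qed

text \<open>Since classes multiply by concatenation, a word evaluated at the generators gives its
  own class. So the generators satisfy the relations, and a map sending each word to its value at
  the generators is the identity.\<close>

lemma weval_pres_gen: "weval (pres_group R) (pres_gen R) w = pres_class R w"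
proof (induction w)
  case Nil
  show ?case by (simp add: pres_group_def)
next
  case (Cons c w)
  then show ?case
    by (cases c) (simp_all add: inv_pres_gen, simp_all add: pres_gen_def pres_group_mult)
qed

lemma weval_pres_gen_rel:
  "(u, w) \<in> R \<Longrightarrow> weval (pres_group R) (pres_gen R) u = weval (pres_group R) (pres_gen R) w"
  by (simp add: weval_pres_gen pres_class_eq_iff pres_rel)

text \<open>Von Dyck's theorem gives homomorphisms in both directions, and they are mutually inverse
  once they are so on generators. As they are built only inside the proof, \<open>hf\<close> and
  \<open>fh\<close> speak of any homomorphism with the prescribed values on generators.\<close>

lemma pres_group_isoI:
  fixes R :: "('g word \<times> 'g word) set" and S :: "('h word \<times> 'h word) set"
  assumes f: "range f \<subseteq> carrier (pres_group S)"
    and fR: "\<And>u w. (u, w) \<in> R \<Longrightarrow> weval (pres_group S) f u = weval (pres_group S) f w"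
    and h: "range h \<subseteq> carrier (pres_group R)"
    and hS: "\<And>u w. (u, w) \<in> S \<Longrightarrow> weval (pres_group R) h u = weval (pres_group R) h w"
    and hf: "\<And>\<psi> g. \<psi> \<in> hom (pres_group S) (pres_group R) \<Longrightarrow> (\<And>g. \<psi> (pres_gen S g) = h g) \<Longrightarrow>
               \<psi> (f g) = pres_gen R g"
    and fh: "\<And>\<phi> g. \<phi> \<in> hom (pres_group R) (pres_group S) \<Longrightarrow> (\<And>g. \<phi> (pres_gen R g) = f g) \<Longrightarrow>
               \<phi> (h g) = pres_gen S g"
  shows "\<exists>\<phi> \<in> iso (pres_group R) (pres_group S). \<forall>g. \<phi> (pres_gen R g) = f g"
proof -
  interpret R: group "pres_group R" by (rule group_pres_group)
  interpret S: group "pres_group S" by (rule group_pres_group)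
  have gen: "weval H f [Pos g] = f g" if "group H" "range f \<subseteq> carrier H"
    for H :: "('x, 'y) monoid_scheme" and f :: "'z \<Rightarrow> 'x" and g
  proof -
    interpret group H by fact
    show ?thesis using that by (auto simp: image_subset_iff)
  qed
  obtain \<phi> where \<phi>: "\<phi> \<in> hom (pres_group R) (pres_group S)"
    and \<phi>_class: "\<And>w. \<phi> (pres_class R w) = weval (pres_group S) f w"
    using S.pres_group_universal[OF f fR] by blast
  obtain \<psi> where \<psi>: "\<psi> \<in> hom (pres_group S) (pres_group R)"
    and \<psi>_class: "\<And>w. \<psi> (pres_class S w) = weval (pres_group R) h w"
    using R.pres_group_universal[OF h hS] by blast
  have \<phi>_gen: "\<phi> (pres_gen R g) = f g" for g
    unfolding pres_gen_def \<phi>_class using gen[OF S.group_axioms f] .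
  have \<psi>_gen: "\<psi> (pres_gen S g) = h g" for g
    unfolding pres_gen_def \<psi>_class using gen[OF R.group_axioms h] .
  \<comment> \<open>Homomorphisms commute with evaluation of words, so the round trip evaluates each
    word at the generators themselves.\<close>
  have "\<psi> \<circ> f = pres_gen R" using hf[OF \<psi> \<psi>_gen] by auto
  then have \<psi>\<phi>: "\<psi> (\<phi> (pres_class R w)) = pres_class R w" for w
    unfolding \<phi>_class weval_hom[OF S.group_axioms R.group_axioms \<psi> f] by (simp add: weval_pres_gen)
  have "\<phi> \<circ> h = pres_gen S" using fh[OF \<phi> \<phi>_gen] by auto
  then have \<phi>\<psi>: "\<phi> (\<psi> (pres_class S w)) = pres_class S w" for w
    unfolding \<psi>_class weval_hom[OF R.group_axioms S.group_axioms \<phi> h] by (simp add: weval_pres_gen)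
  have "bij_betw \<phi> (carrier (pres_group R)) (carrier (pres_group S))"
  proof (rule bij_betw_byWitness[where f' = \<psi>])
    show "\<forall>A\<in>carrier (pres_group R). \<psi> (\<phi> A) = A" by (auto simp: pres_group_def \<psi>\<phi>)
    show "\<forall>A\<in>carrier (pres_group S). \<phi> (\<psi> A) = A" by (auto simp: pres_group_def \<phi>\<psi>)
    show "\<phi> ` carrier (pres_group R) \<subseteq> carrier (pres_group S)"
      using \<phi> by (auto simp: hom_def)
    show "\<psi> ` carrier (pres_group S) \<subseteq> carrier (pres_group R)"
      using \<psi> by (auto simp: hom_def)
  qed
  with \<phi> \<phi>_gen show ?thesis by (auto simp: iso_def)
qed

section \<open>The two systems of relations\<close>

text \<open>The abbreviations \<open>v\<close>, \<open>b\<close>, \<open>z\<close> are parameters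
  with defining equations, so that proofs can work with short names; right-hand sides keep the
  bracketing that \<open>weval\<close> produces.\<close>

locale G_relations = group +
  fixes a x v b z and r k l :: nat
  assumes ax [simp]: "a \<in> carrier G" "x \<in> carrier G"
    and v_def: "v = commut a x" and b_def: "b = commut v a" and z_def: "z = v [^] (2 ^ r :: nat)"
    and a_pow: "a [^] (2 ^ (r + 2) :: nat) = \<one>"
    and v_pow: "v [^] (2 ^ (r + 1) :: nat) = \<one>"
    and b_pow: "b [^] (2 ^ r :: nat) = \<one>"
    and vb: "commut v b = \<one>"
    and x2: "x [^] (2::nat) = z [^] k"
    and bx: "conjug b x = inv b"
    and vx: "conjug v x = inv v"
    and ba: "conjug b a = inv b"
    and a4: "a [^] (4::nat) = inv v [^] (2::nat) \<otimes> (inv b \<otimes> z [^] l)"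

text \<open>Here \<open>y\<close> stands for the generator \<open>b_1\<close>, leaving the name
  \<open>b\<close> to the commutator in \<open>G(k,l)\<close>.\<close>

locale G2_relations = group +
  fixes a y c and e k l :: nat
  assumes ay [simp]: "a \<in> carrier G" "y \<in> carrier G"
    and c_def: "c = a [^] (2 ^ (e - 1) :: nat) \<otimes> y [^] (2 ^ (e - 1) :: nat)"
    and a_pow: "a [^] (2 ^ e :: nat) = \<one>"
    and y_pow: "y [^] (2 ^ e :: nat) = \<one>"
    and y2a2: "commut (y [^] (2::nat)) (a [^] (2::nat)) = \<one>"
    and commut_ya: "commut y a = a [^] (2::nat) \<otimes> (inv y [^] (2::nat) \<otimes> c [^] k)"
    and y2a: "conjug (y [^] (2::nat)) a = inv y [^] (2::nat) \<otimes> c [^] l"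
    and a2y: "conjug (a [^] (2::nat)) y = inv a [^] (2::nat) \<otimes> c [^] l"

text \<open>Bridge between words and group elements. One direction extracts usable equations from a
  presented group, the other supplies the hypothesis of von Dyck's theorem.\<close>

lemma (in group) G_relations_iff:
  assumes f: "range f \<subseteq> carrier G"
  defines "a \<equiv> f gen_a" and "x \<equiv> f gen_x"
  shows "(\<forall>(u, w) \<in> rels_G r k l. weval G f u = weval G f w) \<longleftrightarrow>
    G_relations G a x (commut a x) (commut (commut a x) a) (commut a x [^] (2 ^ r :: nat)) r k l"
proof -
  have fg: "f g \<in> carrier G" for g using f by auto
  show ?thesis
    unfolding rels_G_def Let_def G_relations_def G_relations_axioms_def a_def x_def
    by (simp add: weval_append[OF f] weval_wpow[OF f] weval_winv[OF f] weval_wconj[OF f]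
        weval_wcomm[OF f] fg group_axioms del: power_Suc)
qed

lemma (in group) G2_relations_iff:
  assumes f: "range f \<subseteq> carrier G"
  defines "a \<equiv> f gen_a1" and "y \<equiv> f gen_b1"
  shows "(\<forall>(u, w) \<in> rels_G2 e k l. weval G f u = weval G f w) \<longleftrightarrow>
    G2_relations G a y (a [^] (2 ^ (e - 1) :: nat) \<otimes> y [^] (2 ^ (e - 1) :: nat)) e k l"
proof -
  have fg: "f g \<in> carrier G" for g using f by auto
  show ?thesis
    unfolding rels_G2_def Let_def G2_relations_def G2_relations_axioms_def a_def y_def
    by (simp add: weval_append[OF f] weval_wpow[OF f] weval_winv[OF f] weval_wconj[OF f]
        weval_wcomm[OF f] fg group_axioms del: power_Suc)
qed

section \<open>Passing between the two systems of relations\<close>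

lemma (in group) pow_four: "x \<in> carrier G \<Longrightarrow> x [^] (4::nat) = (x \<otimes> x) \<otimes> (x \<otimes> x)"
  using nat_pow_pow[of x 2 2] by (simp add: pow_two)

lemma (in group) commute_mult:
  assumes "g \<in> carrier G" "x \<in> carrier G" "y \<in> carrier G" "g \<otimes> x = x \<otimes> g" "g \<otimes> y = y \<otimes> g"
  shows "g \<otimes> (x \<otimes> y) = (x \<otimes> y) \<otimes> g"
  using assms by (metis m_assoc)

text \<open>The elements \<open>A = a^2\<close>, \<open>v\<close>, \<open>b\<close>,
  \<open>z\<close> commute pairwise, and \<open>B = A v t\<close> with \<open>t = z^k\<close>; each
  relation becomes an identity between monomials in them. The element \<open>c\<close> of the target
  is \<open>z\<close>.\<close>

lemma (in G_relations) G2_relations: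
  assumes "r \<ge> 1"
  shows "G2_relations G a (a \<otimes> x) z (r + 2) k l"
proof -
  define A y B s t where defs: "A = a \<otimes> a" "y = a \<otimes> x" "B = y \<otimes> y" "s = z [^] l" "t = z [^] k"
  have closed [simp]: "v \<in> carrier G" "b \<in> carrier G" "z \<in> carrier G" "A \<in> carrier G"
    "y \<in> carrier G" "B \<in> carrier G" "s \<in> carrier G" "t \<in> carrier G"
    by (simp_all add: v_def b_def z_def defs)
  have vb': "v \<otimes> b = b \<otimes> v" using vb by (simp add: commut_eq_one_iff)
  have va: "conjug v a = v \<otimes> b" by (simp add: b_def conjug_eq_mult_commut)
  have ax': "conjug a x = a \<otimes> v" by (simp add: v_def conjug_eq_mult_commut)
  have z2: "z \<otimes> z = \<one>"
    using v_pow by (simp add: z_def nat_pow_mult flip: mult_2)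
  \<comment> \<open>As \<open>v\<close> and \<open>b\<close> commute,
    \<open>z^a = (v b)^(2^r)\<close> splits into \<open>z\<close> times \<open>b^(2^r)\<close>,
    which is trivial.\<close>
  have "conjug z a = z"
    by (simp add: z_def conjug_pow va pow_mult_distrib vb' b_pow)
  then have za: "z \<otimes> a = a \<otimes> z" by (simp add: conjug_triv_iff)
  have zv: "z \<otimes> v = v \<otimes> z" by (simp add: z_def pow_commute)
  have zA: "z \<otimes> A = A \<otimes> z" by (simp add: defs commute_mult za)
  have zb: "z \<otimes> b = b \<otimes> z" by (simp add: z_def pow_commute vb')
  have tz: "t \<otimes> g = g \<otimes> t" if "z \<otimes> g = g \<otimes> z" "g \<in> carrier G" for g
    using that by (simp add: defs pow_commute)
  have t2: "t \<otimes> t = \<one>"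
    by (simp add: defs z2 flip: pow_mult_distrib)
  \<comment> \<open>Conjugating by \<open>a\<close> twice sends \<open>v\<close> to
    \<open>v b\<close> and then to \<open>v b b^-1\<close>.\<close>
  have "conjug v A = v"
    by (simp add: defs conjug_conjug va conjug_mult ba m_assoc)
  then have vA: "v \<otimes> A = A \<otimes> v" by (simp add: conjug_triv_iff)
  have "conjug b A = b"
    by (simp add: defs conjug_conjug ba conjug_inv)
  then have bA: "b \<otimes> A = A \<otimes> b" by (simp add: conjug_triv_iff)
  have "B = a \<otimes> (x \<otimes> x) \<otimes> conjug a x"
    by (simp add: defs conjug_def m_assoc)
  also have "x \<otimes> x = t" using x2 by (simp add: pow_two defs)
  also have "a \<otimes> t \<otimes> conjug a x = A \<otimes> v \<otimes> t"
    by (simp add: ax' defs(1) m_assoc tz zv tz[OF za] commute_left[OF _ _ _ tz[OF za]])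
  finally have B: "B = A \<otimes> v \<otimes> t" .
  \<comment> \<open>Oriented to sort products into the order \<open>A\<close>, \<open>v\<close>,
    \<open>b\<close>, \<open>t\<close>; the next line adds the variants for nested products.\<close>
  note comm = vA bA vb'[symmetric] tz[OF zA] tz[OF zv] tz[OF zb]
  note comm = comm comm[THEN commute_left[rotated 3]]
  have a4': "A \<otimes> A \<otimes> v \<otimes> v \<otimes> b = s"
  proof -
    have "A \<otimes> A = inv v \<otimes> inv v \<otimes> inv b \<otimes> s"
      using a4 by (simp add: pow_four pow_two defs m_assoc)
    then have "b \<otimes> (v \<otimes> (v \<otimes> (A \<otimes> A))) = s" by (simp add: m_assoc)
    then show ?thesis by (simp add: m_assoc comm)
  qed
  \<comment> \<open>\<open>r \<ge> 1\<close> makes the exponent even, so the factor \<open>t\<close>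
    drops out of \<open>2^r\<close>-th powers.\<close>
  have tr: "t [^] (2 ^ r :: nat) = \<one>" using assms t2 by (simp add: involution_pow_even)
  have Ar: "A [^] (2 ^ r :: nat) \<otimes> A [^] (2 ^ r :: nat) = \<one>"
    using a_pow by (simp add: defs nat_pow_mult pow_two_pow_Suc flip: mult_2 power_Suc)
  have Br: "B [^] (2 ^ r :: nat) = A [^] (2 ^ r :: nat) \<otimes> z"
    by (simp add: B pow_mult_distrib comm m_assoc tr z_def)
  have zAr: "z \<otimes> A [^] (2 ^ r :: nat) = A [^] (2 ^ r :: nat) \<otimes> z"
    using pow_commute[OF _ _ zA[symmetric]] by simp
  have AB: "A \<otimes> B = B \<otimes> A" by (simp add: B m_assoc comm)
  have Aa: "conjug A a = A" by (simp add: defs conjug_triv_iff m_assoc)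
  have ta: "conjug t a = t" by (simp add: conjug_triv_iff tz za)
  \<comment> \<open>Since \<open>B^a = A v b t\<close>, the product \<open>B B^a\<close> is
    \<open>A^2 v^2 b t^2\<close>, which is \<open>s\<close> by \<open>a4'\<close>.\<close>
  have conjug_B: "conjug B a = inv B \<otimes> s"
  proof -
    have "B \<otimes> conjug B a = s"
      by (simp add: B conjug_mult va Aa ta m_assoc comm t2 flip: a4')
    then show ?thesis by (simp add: inv_solve_left)
  qed
  \<comment> \<open>As \<open>a\<close> fixes \<open>A\<close>,
    \<open>A^y = A^x = (a v)^2 = A v^a v\<close>; multiplying by \<open>A\<close> again gives the
    left side of \<open>a4'\<close>.\<close>
  have conjug_A: "conjug A y = inv A \<otimes> s"
  proof -
    have "conjug A y = conjug (a \<otimes> a) x" using Aa by (simp add: defs(2) conjug_conjug) (simp add: defs)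
    also have "\<dots> = a \<otimes> a \<otimes> conjug v a \<otimes> v" by (simp add: conjug_mult ax') (simp add: conjug_def m_assoc)
    also have "\<dots> = A \<otimes> v \<otimes> v \<otimes> b" by (simp add: va m_assoc comm) (simp add: defs m_assoc)
    finally have "A \<otimes> conjug A y = s" by (simp add: m_assoc flip: a4')
    then show ?thesis by (simp add: inv_solve_left)
  qed
  \<comment> \<open>Because \<open>a\<close> commutes with itself,
    \<open>[a, a x] = [a, x] = v\<close>; then \<open>v^-1 = A B^-1 t\<close> is read off from
    \<open>B\<close>.\<close>
  have commut_y: "commut y a = A \<otimes> (inv B \<otimes> t)"
  proof -
    have "a \<otimes> commut a y = conjug (conjug a a) x" by (simp add: defs conjug_conjug flip: conjug_eq_mult_commut)
    also have "\<dots> = a \<otimes> v" by (simp add: conjug_def[of a a] ax')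
    finally have "commut a y = v" by simp
    then have "commut y a = inv v" using inv_commut[of a y] by simp
    moreover have "B = t \<otimes> (v \<otimes> A)" by (simp add: B comm m_assoc)
    ultimately show ?thesis by (simp add: inv_mult_group m_assoc)
  qed
  show ?thesis
  proof
    \<comment> \<open>Both powers have exponent \<open>2^(r+1)\<close>, so the product is
      \<open>A^(2^r) B^(2^r) = A^(2^(r+1)) z\<close>, and the first factor is trivial.\<close>
    show "z = a [^] (2 ^ (r + 2 - 1) :: nat) \<otimes> (a \<otimes> x) [^] (2 ^ (r + 2 - 1) :: nat)"
      using Ar by (simp add: pow_two_pow_Suc Br flip: defs(1,2) defs(3) m_assoc del: power_Suc)
    have "y [^] (2 ^ (r + 2) :: nat) = B [^] (2 ^ r :: nat) \<otimes> B [^] (2 ^ r :: nat)"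
      by (simp add: defs(3) nat_pow_mult pow_two_pow_Suc flip: mult_2 power_Suc)
    also have "\<dots> = \<one>"
      using Ar by (simp add: Br m_assoc zAr z2 commute_left[OF _ _ _ zAr])
    finally show "(a \<otimes> x) [^] (2 ^ (r + 2) :: nat) = \<one>" by (simp add: defs)
    show "commut ((a \<otimes> x) [^] (2::nat)) (a [^] (2::nat)) = \<one>"
      using AB by (simp add: pow_two commut_eq_one_iff defs)
    show "commut (a \<otimes> x) a = a [^] (2::nat) \<otimes> (inv (a \<otimes> x) [^] (2::nat) \<otimes> z [^] k)"
      using commut_y by (simp add: pow_two defs inv_mult_group m_assoc)
    show "conjug ((a \<otimes> x) [^] (2::nat)) a = inv (a \<otimes> x) [^] (2::nat) \<otimes> z [^] l"
      using conjug_B by (simp add: pow_two defs inv_mult_group m_assoc)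
    show "conjug (a [^] (2::nat)) (a \<otimes> x) = inv a [^] (2::nat) \<otimes> z [^] l"
      using conjug_A by (simp add: pow_two defs inv_mult_group)
  qed (use a_pow in simp_all)
qed

text \<open>Once \<open>c\<close> is known to commute with \<open>a\<close> and \<open>y\<close> and
  to square to one, \<open>v = A^-1 B t\<close> and \<open>b = B^-2 s\<close> follow, with
  \<open>s = c^l\<close> and \<open>t = c^k\<close>. The remaining relations are computed with these
  monomials.\<close>

lemma (in G2_relations) G_relations:
  assumes "r \<ge> 1" "e = r + 2"
  defines "x \<equiv> inv a \<otimes> y"
  shows "G_relations G a x (commut a x) (commut (commut a x) a) (commut a x [^] (2 ^ r :: nat)) r k l"
proof -
  define A B s t v b where defs: "A = a \<otimes> a" "B = y \<otimes> y" "s = c [^] l" "t = c [^] k"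
    "v = commut a x" "b = commut v a"
  have closed [simp]: "x \<in> carrier G" "A \<in> carrier G" "c \<in> carrier G"
    "B \<in> carrier G" "s \<in> carrier G" "t \<in> carrier G" "v \<in> carrier G" "b \<in> carrier G"
    by (simp_all add: defs x_def c_def)
  have BA: "B \<otimes> A = A \<otimes> B" using y2a2 by (simp add: defs pow_two commut_eq_one_iff)
  have c: "c = A [^] (2 ^ r :: nat) \<otimes> B [^] (2 ^ r :: nat)"
    by (simp add: c_def assms(2) defs pow_two_pow_Suc del: power_Suc)
  have Ar: "A [^] (2 ^ r :: nat) \<otimes> A [^] (2 ^ r :: nat) = \<one>"
    using a_pow by (simp add: assms(2) defs nat_pow_mult pow_two_pow_Suc flip: mult_2 power_Suc)
  have Br: "B [^] (2 ^ r :: nat) \<otimes> B [^] (2 ^ r :: nat) = \<one>"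
    using y_pow by (simp add: assms(2) defs nat_pow_mult pow_two_pow_Suc flip: mult_2 power_Suc)
  have cA: "c \<otimes> A = A \<otimes> c"
    unfolding c by (rule commute_mult[symmetric]) (simp_all add: BA pow_commute[symmetric])
  have cB: "c \<otimes> B = B \<otimes> c"
    unfolding c by (rule commute_mult[symmetric]) (simp_all add: BA[symmetric] pow_commute[symmetric])
  have AB_pow: "B [^] (2 ^ r :: nat) \<otimes> A [^] (2 ^ r :: nat) = A [^] (2 ^ r :: nat) \<otimes> B [^] (2 ^ r :: nat)"
  proof -
    have "A [^] (2 ^ r :: nat) \<otimes> B = B \<otimes> A [^] (2 ^ r :: nat)"
      using pow_commute[OF _ _ BA[symmetric]] by simp
    then show ?thesis using pow_commute[of B] by simp
  qed
  have c2: "c \<otimes> c = \<one>"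
    using Ar Br by (simp add: c m_assoc commute_left[OF _ _ _ AB_pow])
  have s2: "s \<otimes> s = \<one>" and t2: "t \<otimes> t = \<one>"
    by (simp_all add: defs c2 flip: pow_mult_distrib)
  have st: "g \<otimes> s = s \<otimes> g" "g \<otimes> t = t \<otimes> g" if "c \<otimes> g = g \<otimes> c" "g \<in> carrier G" for g
    using that by (simp_all add: defs pow_commute)
  have inv_st: "inv s = s" "inv t = t" using s2 t2 by (simp_all add: inv_equality)
  have Ba: "conjug B a = inv B \<otimes> s" and Ay: "conjug A y = inv A \<otimes> s"
    using y2a a2y by (simp_all add: defs pow_two inv_mult_group)
  have Aa: "conjug A a = A" and By: "conjug B y = B" by (simp_all add: defs conjug_triv_iff m_assoc)
  \<comment> \<open>For \<open>r \<ge> 1\<close> the factor \<open>s\<close> vanishes in the power,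
    and \<open>g^(2^r)\<close> is its own inverse. Since conjugation by \<open>a\<close> sends
    \<open>B\<close> to \<open>B^-1 s\<close>, and by \<open>y\<close> sends \<open>A\<close> to
    \<open>A^-1 s\<close>, this is why both fix \<open>c\<close>.\<close>
  have twist: "(inv g \<otimes> s) [^] (2 ^ r :: nat) = g [^] (2 ^ r :: nat)"
    if "c \<otimes> g = g \<otimes> c" "g \<in> carrier G" "g [^] (2 ^ r :: nat) \<otimes> g [^] (2 ^ r :: nat) = \<one>" for g
  proof -
    have "inv g \<otimes> s = s \<otimes> inv g" using that by (intro inv_commute st) simp_all
    then show ?thesis
      using that assms(1) s2
      by (simp add: pow_mult_distrib involution_pow_even nat_pow_inv inv_equality)
  qed
  have "conjug c a = c"
    by (simp add: c conjug_mult conjug_pow Aa Ba twist[OF cB _ Br])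
  then have ca: "c \<otimes> a = a \<otimes> c" by (simp add: conjug_triv_iff)
  have "conjug c y = c"
    by (simp add: c conjug_mult conjug_pow By Ay twist[OF cA _ Ar])
  then have cy: "c \<otimes> y = y \<otimes> c" by (simp add: conjug_triv_iff)
  have s_conjug: "conjug s a = s" "conjug s y = s" "conjug t a = t" "conjug t y = t"
    by (simp_all add: conjug_triv_iff st ca cy)
  have st': "s \<otimes> t = t \<otimes> s" by (simp add: defs nat_pow_mult add.commute)
  \<comment> \<open>Sorting rules that move \<open>t\<close> and \<open>s\<close> to the front and
    \<open>A\<close>, \<open>inv A\<close> before \<open>B\<close>, \<open>inv B\<close>;
    \<open>norm\<close> adds the cancellation of repeated \<open>s\<close> and
    \<open>t\<close>.\<close>
  note comm = BA inv_commute[OF _ _ BA] inv_commute[OF _ _ BA[symmetric], symmetric]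
    inv_commute[OF _ _ inv_commute[OF _ _ BA[symmetric], symmetric]]
    st[OF cA] st[OF cB] st[OF cA, THEN inv_commute[rotated 2]] st[OF cB, THEN inv_commute[rotated 2]] st'
  note norm = m_assoc comm comm[THEN commute_left[rotated 3]] s2 t2 inv_st inv_mult_group
    inv_mult_cancel_left[of s, unfolded inv_st] inv_mult_cancel_left[of t, unfolded inv_st]
  have ax: "a \<otimes> x = y" by (simp add: x_def)
  have commut_ya': "commut y a = A \<otimes> inv B \<otimes> t"
    using commut_ya by (simp add: defs pow_two inv_mult_group m_assoc)
  have v: "v = inv A \<otimes> B \<otimes> t"
  proof -
    have "a \<otimes> commut a y = conjug (conjug a a) x" by (simp add: conjug_conjug[symmetric] ax flip: conjug_eq_mult_commut)
    also have "\<dots> = a \<otimes> v" by (simp add: conjug_def[of a a] defs(5) conjug_eq_mult_commut)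
    finally have "v = commut a y" by simp
    also have "\<dots> = inv (A \<otimes> inv B \<otimes> t)" by (simp add: inv_commut flip: commut_ya')
    finally show ?thesis by (simp add: norm)
  qed
  have va: "conjug v a = inv A \<otimes> inv B \<otimes> s \<otimes> t"
    by (simp add: v conjug_mult conjug_inv Aa Ba s_conjug norm)
  \<comment> \<open>From \<open>v b = v^a\<close>, cancelling \<open>v\<close> on the left.\<close>
  have b: "b = inv B \<otimes> (inv B \<otimes> s)"
  proof -
    have "v \<otimes> b = v \<otimes> (inv B \<otimes> (inv B \<otimes> s))"
      by (simp add: defs(6) va flip: conjug_eq_mult_commut) (simp add: v norm)
    then show ?thesis by simp
  qed
  have tr: "t [^] (2 ^ r :: nat) = \<one>" using assms(1) t2 by (simp add: involution_pow_even)
  \<comment> \<open>\<open>t^(2^r)\<close> is trivial and \<open>A^(2^r)\<close> is its own inverse,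
    so the power of \<open>A^-1 B t\<close> is \<open>A^(2^r) B^(2^r)\<close>.\<close>
  have z: "v [^] (2 ^ r :: nat) = c"
    using Ar
    by (simp add: v pow_mult_distrib norm tr nat_pow_inv c inv_equality)
  have br: "b [^] (2 ^ r :: nat) = \<one>"
  proof -
    have "b [^] (2 ^ r :: nat) = inv B [^] (2 ^ r :: nat) \<otimes> (inv B \<otimes> s) [^] (2 ^ r :: nat)"
      unfolding b by (rule pow_mult_distrib) (simp_all add: norm)
    then show ?thesis by (simp add: twist[OF cB _ Br] Br nat_pow_inv)
  qed
  have ba: "conjug b a = inv b" by (simp add: b conjug_mult conjug_inv Ba s_conjug norm)
  \<comment> \<open>With \<open>x = a^-1 y\<close>: both \<open>a\<close> and \<open>a^-1\<close>
    invert \<open>b\<close>, while \<open>y\<close> fixes it, \<open>b\<close> being a word in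
    \<open>y^2\<close> and \<open>s\<close>.\<close>
  have bx: "conjug b x = inv b"
  proof -
    have "conjug b (inv a) = inv b"
      by (rule conjug_invI) (simp_all add: conjug_inv ba)
    moreover have "conjug (inv b) y = inv b" by (simp add: b conjug_mult conjug_inv By s_conjug norm)
    ultimately show ?thesis by (simp add: x_def conjug_conjug)
  qed
  \<comment> \<open>\<open>a^-1\<close> sends \<open>v\<close> to \<open>A^-1 B^-1 s t\<close>, and
    \<open>y\<close> sends this to \<open>A B^-1 t = v^-1\<close>, the two factors \<open>s\<close>
    cancelling.\<close>
  have vx: "conjug v x = inv v"
  proof -
    have "conjug v (inv a) = inv A \<otimes> inv B \<otimes> s \<otimes> t"
      by (rule conjug_invI) (simp_all add: v conjug_mult conjug_inv Aa Ba s_conjug norm)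
    moreover have "conjug (inv A \<otimes> inv B \<otimes> s \<otimes> t) y = inv v"
      by (simp add: v conjug_mult conjug_inv By Ay s_conjug norm)
    ultimately show ?thesis by (simp add: x_def conjug_conjug)
  qed
  \<comment> \<open>Rewrite \<open>a^-1 y a^-1 y\<close> as \<open>y^a A^-1 y\<close> and insert
    \<open>y^a = y [y,a]\<close>; what is left is \<open>y t B^-1 y\<close> with
    \<open>B = y^2\<close>.\<close>
  have x2: "x \<otimes> x = t"
  proof -
    have "x \<otimes> x = conjug y a \<otimes> inv A \<otimes> y" by (simp add: x_def conjug_def defs(1) m_assoc inv_mult_group)
    also have "\<dots> = y \<otimes> (A \<otimes> inv B \<otimes> t \<otimes> inv A) \<otimes> y" by (simp add: conjug_eq_mult_commut commut_ya' m_assoc)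
    also have "A \<otimes> inv B \<otimes> t \<otimes> inv A = t \<otimes> inv B" by (simp add: norm)
    also have "y \<otimes> (t \<otimes> inv B) \<otimes> y = t"
      by (simp add: defs(2) m_assoc inv_mult_group st cy commute_left[OF _ _ _ st(2)[OF cy]])
    finally show ?thesis .
  qed
  have vb: "v \<otimes> b = b \<otimes> v" by (simp add: v b norm)
  have a4: "A \<otimes> A = inv v \<otimes> inv v \<otimes> (inv b \<otimes> s)" by (simp add: v b norm)
  show ?thesis
    unfolding defs(5,6)[symmetric] z
  proof
    show "c = v [^] (2 ^ r :: nat)" by (simp add: z)
    show "a [^] (2 ^ (r + 2) :: nat) = \<one>" using a_pow assms(2) by simp
    show "v [^] (2 ^ (r + 1) :: nat) = \<one>"
      using c2 by (simp add: nat_pow_mult flip: z mult_2)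
    show "commut v b = \<one>" by (simp add: vb commut_eq_one_iff)
    show "x [^] (2::nat) = c [^] k" by (simp add: pow_two x2 defs(4))
    show "a [^] (4::nat) = inv v [^] (2::nat) \<otimes> (inv b \<otimes> c [^] l)"
      using a4 by (simp add: pow_four pow_two flip: defs(1,3))
  qed (simp_all add: defs(5,6)[symmetric] br ba bx vx)
qed

section \<open>Mutually inverse homomorphisms between the presented groups\<close>

theorem theorem4p2:
  fixes r e k l :: nat
  assumes "r \<ge> 2" and "e = r + 2" and "k \<in> {0, 1}" and "l \<in> {0, 1}"
  shows "\<exists>\<phi> \<in> iso (grp_G r k l) (grp_G2 e k l).
           \<phi> (pres_gen (rels_G r k l) gen_a) = pres_gen (rels_G2 e k l) gen_a1 \<and>
           \<phi> (pres_gen (rels_G r k l) gen_x) =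
             inv\<^bsub>grp_G2 e k l\<^esub> (pres_gen (rels_G2 e k l) gen_a1)
               \<otimes>\<^bsub>grp_G2 e k l\<^esub> pres_gen (rels_G2 e k l) gen_b1"
proof -
  define R S where "R = rels_G r k l" and "S = rels_G2 e k l"
  interpret R: group "pres_group R" by (rule group_pres_group)
  interpret S: group "pres_group S" by (rule group_pres_group)
  have gens [simp]: "pres_gen R g \<in> carrier (pres_group R)" "pres_gen S g' \<in> carrier (pres_group S)"
    for g g' using pres_gen_closed[of R] pres_gen_closed[of S] by auto
  define f where "f = case_gens_G (pres_gen S gen_a1)
    (inv\<^bsub>pres_group S\<^esub> pres_gen S gen_a1 \<otimes>\<^bsub>pres_group S\<^esub> pres_gen S gen_b1)"
  \<comment> \<open>The inverse assignment is forced: \<open>x = a^-1 y\<close> solves to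
    \<open>y = a x\<close>.\<close>
  define h where "h = case_gens_G2 (pres_gen R gen_a)
    (pres_gen R gen_a \<otimes>\<^bsub>pres_group R\<^esub> pres_gen R gen_x)"
  have f: "range f \<subseteq> carrier (pres_group S)"
    by (auto simp: f_def split: gens_G.split)
  have h: "range h \<subseteq> carrier (pres_group R)"
    by (auto simp: h_def split: gens_G2.split)
  have "\<exists>z. G2_relations (pres_group S) (pres_gen S gen_a1) (pres_gen S gen_b1) z e k l"
    using S.G2_relations_iff[OF pres_gen_closed, of e k l] weval_pres_gen_rel[of _ _ S]
    unfolding S_def by blast
  then have fR: "weval (pres_group S) f u = weval (pres_group S) f w" if "(u, w) \<in> R" for u w
    using that G2_relations.G_relations[of "pres_group S" _ _ _ e k l r] assms(1,2)
      S.G_relations_iff[OF f, of r k l] by (auto simp: f_def R_def)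
  have "G_relations (pres_group R) (pres_gen R gen_a) (pres_gen R gen_x)
      (R.commut (pres_gen R gen_a) (pres_gen R gen_x))
      (R.commut (R.commut (pres_gen R gen_a) (pres_gen R gen_x)) (pres_gen R gen_a))
      (R.commut (pres_gen R gen_a) (pres_gen R gen_x) [^]\<^bsub>pres_group R\<^esub> (2 ^ r :: nat)) r k l"
    using R.G_relations_iff[OF pres_gen_closed, of r k l] weval_pres_gen_rel[of _ _ R]
    unfolding R_def by blast
  from G_relations.G2_relations[OF this] obtain c where c: "G2_relations (pres_group R) (h gen_a1) (h gen_b1) c e k l"
    using assms(1,2) by (auto simp: h_def)
  \<comment> \<open>The witness \<open>c\<close> is replaced by its defining product, the form in
    which \<open>G2_relations_iff\<close> states the relations.\<close>
  have "G2_relations (pres_group R) (h gen_a1) (h gen_b1)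
      (h gen_a1 [^]\<^bsub>pres_group R\<^esub> (2 ^ (e - 1) :: nat) \<otimes>\<^bsub>pres_group R\<^esub>
       h gen_b1 [^]\<^bsub>pres_group R\<^esub> (2 ^ (e - 1) :: nat)) e k l"
    using c unfolding G2_relations.c_def[OF c, symmetric] .
  then have hS: "weval (pres_group R) h u = weval (pres_group R) h w" if "(u, w) \<in> S" for u w
    using that R.G2_relations_iff[OF h, of e k l] by (auto simp: S_def)
  \<comment> \<open>On generators the round trip only needs the cancellation
    \<open>a^-1 (a x) = x\<close>; for \<open>fh\<close> it is
    \<open>a_1 (a_1^-1 b_1) = b_1\<close>.\<close>
  have hf: "\<psi> (f g) = pres_gen R g"
    if \<psi>: "\<psi> \<in> hom (pres_group S) (pres_group R)" and \<psi>_gen: "\<And>g. \<psi> (pres_gen S g) = h g" for \<psi> g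
  proof -
    interpret \<psi>: group_hom "pres_group S" "pres_group R" \<psi>
      using \<psi> by unfold_locales
    show ?thesis by (cases g) (simp_all add: f_def h_def \<psi>_gen)
  qed
  have fh: "\<phi> (h g) = pres_gen S g"
    if \<phi>: "\<phi> \<in> hom (pres_group R) (pres_group S)" and \<phi>_gen: "\<And>g. \<phi> (pres_gen R g) = f g" for \<phi> g
  proof -
    interpret \<phi>: group_hom "pres_group R" "pres_group S" \<phi>
      using \<phi> by unfold_locales
    show ?thesis by (cases g) (simp_all add: f_def h_def \<phi>_gen)
  qed
  have "\<exists>\<phi> \<in> iso (pres_group R) (pres_group S). \<forall>g. \<phi> (pres_gen R g) = f g"
    by (rule pres_group_isoI[of f S R h]) (fact f fR h hS hf fh)+
  then obtain \<phi> where "\<phi> \<in> iso (pres_group R) (pres_group S)" "\<And>g. \<phi> (pres_gen R g) = f g"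
    by blast
  then show ?thesis
    unfolding grp_G_def grp_G2_def R_def[symmetric] S_def[symmetric]
    by (intro bexI[of _ \<phi>]) (simp_all add: f_def)
qed

end
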